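(* Let $f:\mathbb{R}\to\mathbb{R}$ be any $C^1$ capitalization factor, and let $[\cdot|\cdot]_f$ and $[\cdot|\cdot]_{(f,-)}$ be the Lie product and the Lie anti-product induced by $f$ on the space $\mathbb{R}^3$ of capitalized events. Then: (1) $\mathbb{R}^3_f=(\mathbb{R}^3,[\cdot|\cdot]_f)$ is a $C^1$ Abelian Lie semigroup with respect to the standard Euclidean differentiable structure on $\mathbb{R}^3$. (2) The origin (neutral element) of the Lie semigroup $\mathbb{R}^3_f$ is the point $o=(0,0,1)$. (3) The subset $\{(t,h,c)\in\mathbb{R}^3: c\neq 0\}$ of non-zero capitalized events is a Lie subgroup of the Lie semigroup $\mathbb{R}^3_f$, and it coincides with the subgroup of the invertible elements of $\mathbb{R}^3_f$. (4) Let $G_f$ denote the set of non-zero events endowed with the product $[\cdot|\cdot]_f$. The Lie group $G_f$ has exactly two connected components, and they are homeomorphic. One of them, the half-space of strict credits $C=\{(t,h,c): c>0\}$, contains the origin $o$ and is a subgroup of $G_f$. The other one, the half-space of strict debts $D=\{(t,h,c): c<0\}$, contains the opposite event $(0,0,-1)$ of the origin and is a group with respect to the anti-product $[\cdot|\cdot]_{(f,-)}$. (5) Let $G_f^{>}$ be $C$ endowed with $[\cdot|\cdot]_f$ and let $G_f^{<}$ be $D$ endowed with $[\cdot|\cdot]_{(f,-)}$. The mapping $(t,h,c)\mapsto(t,h,-c)$ is an isomorphism of Lie groups of $G_f^{>}$ onto $G_f^{<}$.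
   Context: A capitalized (financial) event is any triple $(t,h,c)$ of real numbers. A zero event is one with $c=0$. The opposite of $(t,h,c)$ is $(t,h,-c)$. A $C^1$ capitalization factor is a function $f:\mathbb{R}\to\mathbb{R}$ of class $C^1$ such that $f(h)>0$ for all $h$, $f(0)=1$, and $f(-h)=f(h)^{-1}$ for all $h\in\mathbb{R}$. For $e=(t,h,c)$ and $e'=(t',h',c')$ in $\mathbb{R}^3$, the Lie product induced by $f$ is $$[e|e']_f=\bigl(t+t',\,h+h',\,c f(-h)\,c' f(-h')\,f(h+h')\bigr),$$ and the Lie anti-product induced by $f$ is $$[e|e']_{(f,-)}=\bigl(t+t',\,h+h',\,-c f(-h)\,c' f(-h')\,f(h+h')\bigr).$$ A $C^1$ Lie semigroup is a $C^1$ manifold endowed with an associative product that has a neutral element (called its origin) and is a $C^1$ map; it is Abelian if the product is commutative. A ($C^1$) Lie group is a $C^1$ manifold with a group structure whose product and inversion maps are $C^1$. A Lie subgroup of a Lie semigroup is a submanifold that contains the neutral element, is closed under the product, and is a Lie group under the restricted product. An isomorphism of Lie groups is a group isomorphism that is a $C^1$ diffeomorphism. *)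

theory Defs
  imports "HOL-Analysis.Analysis" "HOL-Algebra.Group"
begin

section \<open>Manifolds of class C1\<close>

text \<open>
  Charts take values in a linear subspace \<open>V\<close> of a Euclidean space, the model space, rather than in
  the whole type. In this way a submanifold of smaller dimension has a manifold structure whose
  charts are of the same type.

  \<open>C1_on V W g\<close>: the map \<open>g\<close> is of class C1 on \<open>W\<close>, a set that is open in the subspace \<open>V\<close>. Only the
  values of \<open>g\<close> on \<open>W\<close> matter, and the derivative is determined in the directions of \<open>V\<close> only, so
  its continuity is required for these directions (in finite dimension this is continuity in the
  operator norm).
\<close>

definition C1_on ::
  "'e::euclidean_space set \<Rightarrow> 'e set \<Rightarrow> ('e \<Rightarrow> 'd::euclidean_space) \<Rightarrow> bool" where
  "C1_on V W g \<longleftrightarrow>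
     (\<exists>D. (\<forall>x\<in>W. (g has_derivative D x) (at x within W)) \<and>
          (\<forall>v\<in>V. continuous_on W (\<lambda>x. D x v)))"

type_synonym ('a, 'e) chart = "'a set \<times> ('a \<Rightarrow> 'e)"

record ('a, 'e) mfd =
  mfd_top :: "'a topology"
  mfd_model :: "'e set"
  mfd_atlas :: "('a, 'e) chart set"

abbreviation mfd_carrier :: "('a, 'e) mfd \<Rightarrow> 'a set" where
  "mfd_carrier M \<equiv> topspace (mfd_top M)"

definition is_chart :: "'a topology \<Rightarrow> 'e::euclidean_space set \<Rightarrow> ('a, 'e) chart \<Rightarrow> bool" where
  "is_chart X V = (\<lambda>(U, \<phi>).
     openin X U \<and> openin (top_of_set V) (\<phi> ` U) \<and>
     homeomorphic_map (subtopology X U) (top_of_set (\<phi> ` U)) \<phi>)"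

definition C1_compatible ::
  "'e::euclidean_space set \<Rightarrow> ('a, 'e) chart \<Rightarrow> ('a, 'e) chart \<Rightarrow> bool" where
  "C1_compatible V = (\<lambda>(U, \<phi>) (U', \<psi>).
     C1_on V (\<phi> ` (U \<inter> U')) (\<psi> \<circ> inv_into U \<phi>) \<and>
     C1_on V (\<psi> ` (U \<inter> U')) (\<phi> \<circ> inv_into U' \<psi>))"

definition C1_manifold :: "('a, 'e::euclidean_space) mfd \<Rightarrow> bool" where
  "C1_manifold M \<longleftrightarrow>
     Hausdorff_space (mfd_top M) \<and> second_countable (mfd_top M) \<and>
     subspace (mfd_model M) \<and>
     (\<forall>c\<in>mfd_atlas M. is_chart (mfd_top M) (mfd_model M) c) \<and>
     (\<Union>c\<in>mfd_atlas M. fst c) = mfd_carrier M \<and>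
     (\<forall>c\<in>mfd_atlas M. \<forall>c'\<in>mfd_atlas M. C1_compatible (mfd_model M) c c')"

definition max_atlas :: "('a, 'e::euclidean_space) mfd \<Rightarrow> ('a, 'e) chart set" where
  "max_atlas M =
     {c. is_chart (mfd_top M) (mfd_model M) c \<and>
         (\<forall>c'\<in>mfd_atlas M. C1_compatible (mfd_model M) c c')}"

text \<open>
  For a continuous map it is enough to have, at every point, one pair of charts in which the map is
  of class C1: the changes of charts are of class C1.
\<close>

definition C1_map ::
  "('a, 'e::euclidean_space) mfd \<Rightarrow> ('b, 'd::euclidean_space) mfd \<Rightarrow> ('a \<Rightarrow> 'b) \<Rightarrow> bool" where
  "C1_map M N F \<longleftrightarrow>
     continuous_map (mfd_top M) (mfd_top N) F \<and>
     (\<forall>p\<in>mfd_carrier M. \<exists>(U, \<phi>)\<in>mfd_atlas M. \<exists>(U', \<psi>)\<in>mfd_atlas N.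
        p \<in> U \<and> F p \<in> U' \<and>
        C1_on (mfd_model M) (\<phi> ` (U \<inter> F -` U')) (\<psi> \<circ> F \<circ> inv_into U \<phi>))"

definition C1_diffeomorphism ::
  "('a, 'e::euclidean_space) mfd \<Rightarrow> ('b, 'd::euclidean_space) mfd \<Rightarrow> ('a \<Rightarrow> 'b) \<Rightarrow> bool" where
  "C1_diffeomorphism M N F \<longleftrightarrow>
     bij_betw F (mfd_carrier M) (mfd_carrier N) \<and>
     C1_map M N F \<and> C1_map N M (inv_into (mfd_carrier M) F)"

definition prod_mfd :: "('a, 'e) mfd \<Rightarrow> ('b, 'd) mfd \<Rightarrow> ('a \<times> 'b, 'e \<times> 'd) mfd" where
  "prod_mfd M N =
     \<lparr>mfd_top = prod_topology (mfd_top M) (mfd_top N),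
      mfd_model = mfd_model M \<times> mfd_model N,
      mfd_atlas = {(U \<times> U', map_prod \<phi> \<psi>) | U \<phi> U' \<psi>.
                     (U, \<phi>) \<in> mfd_atlas M \<and> (U', \<psi>) \<in> mfd_atlas N}\<rparr>"

definition euclidean_mfd :: "('a::euclidean_space, 'a) mfd" where
  "euclidean_mfd = \<lparr>mfd_top = euclidean, mfd_model = UNIV, mfd_atlas = {(UNIV, id)}\<rparr>"

text \<open>
  A submanifold is an embedded submanifold: around each of its points there is a slice chart of the
  ambient manifold, which maps \<open>S\<close> to a linear subspace \<open>W\<close> of the model space. The induced structure
  consists of the subspace topology and the restrictions of all slice charts. The dimension of \<open>S\<close> is
  \<open>dim W\<close>. If \<open>W\<close> is the whole model space, then \<open>S\<close> is an open submanifold.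
\<close>

definition slice_charts ::
  "('a, 'e::euclidean_space) mfd \<Rightarrow> 'e set \<Rightarrow> 'a set \<Rightarrow> ('a, 'e) chart set" where
  "slice_charts M W S = {(U, \<phi>). (U, \<phi>) \<in> max_atlas M \<and> \<phi> ` (U \<inter> S) = \<phi> ` U \<inter> W}"

definition submanifold_modelled_on ::
  "('a, 'e::euclidean_space) mfd \<Rightarrow> 'e set \<Rightarrow> 'a set \<Rightarrow> bool" where
  "submanifold_modelled_on M W S \<longleftrightarrow>
     S \<subseteq> mfd_carrier M \<and> subspace W \<and> W \<subseteq> mfd_model M \<and>
     (\<forall>p\<in>S. \<exists>(U, \<phi>)\<in>slice_charts M W S. p \<in> U)"

definition submfd ::
  "('a, 'e::euclidean_space) mfd \<Rightarrow> 'e set \<Rightarrow> 'a set \<Rightarrow> ('a, 'e) mfd" where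
  "submfd M W S =
     \<lparr>mfd_top = subtopology (mfd_top M) S,
      mfd_model = W,
      mfd_atlas = {(U \<inter> S, \<phi>) | U \<phi>. (U, \<phi>) \<in> slice_charts M W S}\<rparr>"

abbreviation open_submfd ::
  "('a, 'e::euclidean_space) mfd \<Rightarrow> 'a set \<Rightarrow> ('a, 'e) mfd" where
  "open_submfd M S \<equiv> submfd M (mfd_model M) S"


section \<open>Lie semigroups and Lie groups\<close>

text \<open>
  The structure given by a set and a product. The neutral element is not a datum here: it is
  determined by the product, and is an arbitrary value if no neutral element exists.
\<close>

definition alg :: "'a set \<Rightarrow> ('a \<Rightarrow> 'a \<Rightarrow> 'a) \<Rightarrow> 'a monoid" where
  "alg S m =
     \<lparr>carrier = S, monoid.mult = m,
      one = (THE e. e \<in> S \<and> (\<forall>x\<in>S. m e x = x \<and> m x e = x))\<rparr>"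

definition lie_semigroup ::
  "('a, 'e::euclidean_space) mfd \<Rightarrow> ('a \<Rightarrow> 'a \<Rightarrow> 'a) \<Rightarrow> bool" where
  "lie_semigroup M m \<longleftrightarrow>
     C1_manifold M \<and> Group.monoid (alg (mfd_carrier M) m) \<and>
     C1_map (prod_mfd M M) M (\<lambda>(x, y). m x y)"

definition abelian_lie_semigroup ::
  "('a, 'e::euclidean_space) mfd \<Rightarrow> ('a \<Rightarrow> 'a \<Rightarrow> 'a) \<Rightarrow> bool" where
  "abelian_lie_semigroup M m \<longleftrightarrow>
     lie_semigroup M m \<and> Group.comm_monoid (alg (mfd_carrier M) m)"

definition origin :: "('a, 'e::euclidean_space) mfd \<Rightarrow> ('a \<Rightarrow> 'a \<Rightarrow> 'a) \<Rightarrow> 'a" where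
  "origin M m = one (alg (mfd_carrier M) m)"

definition lie_group ::
  "('a, 'e::euclidean_space) mfd \<Rightarrow> ('a \<Rightarrow> 'a \<Rightarrow> 'a) \<Rightarrow> bool" where
  "lie_group M m \<longleftrightarrow>
     C1_manifold M \<and> Group.group (alg (mfd_carrier M) m) \<and>
     C1_map (prod_mfd M M) M (\<lambda>(x, y). m x y) \<and>
     C1_map M M (m_inv (alg (mfd_carrier M) m))"

definition lie_subgroup ::
  "('a, 'e::euclidean_space) mfd \<Rightarrow> ('a \<Rightarrow> 'a \<Rightarrow> 'a) \<Rightarrow> 'a set \<Rightarrow> bool" where
  "lie_subgroup M m S \<longleftrightarrow>
     origin M m \<in> S \<and> (\<forall>x\<in>S. \<forall>y\<in>S. m x y \<in> S) \<and>
     (\<exists>W. submanifold_modelled_on M W S \<and> lie_group (submfd M W S) m)"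

definition lie_group_isomorphism ::
  "('a, 'e::euclidean_space) mfd \<Rightarrow> ('a \<Rightarrow> 'a \<Rightarrow> 'a) \<Rightarrow>
   ('b, 'd::euclidean_space) mfd \<Rightarrow> ('b \<Rightarrow> 'b \<Rightarrow> 'b) \<Rightarrow> ('a \<Rightarrow> 'b) \<Rightarrow> bool" where
  "lie_group_isomorphism M m N n F \<longleftrightarrow>
     lie_group M m \<and> lie_group N n \<and>
     F \<in> Group.iso (alg (mfd_carrier M) m) (alg (mfd_carrier N) n) \<and>
     C1_diffeomorphism M N F"


section \<open>Capitalized events\<close>

type_synonym event = "real \<times> real \<times> real"

definition C1_capitalization_factor :: "(real \<Rightarrow> real) \<Rightarrow> bool" where
  "C1_capitalization_factor f \<longleftrightarrow>
     f C1_differentiable_on UNIV \<and> (\<forall>h. f h > 0) \<and> f 0 = 1 \<and> (\<forall>h. f (- h) = inverse (f h))"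

fun opposite :: "event \<Rightarrow> event" where
  "opposite (t, h, c) = (t, h, - c)"

fun lie_product :: "(real \<Rightarrow> real) \<Rightarrow> event \<Rightarrow> event \<Rightarrow> event" where
  "lie_product f (t, h, c) (t', h', c') =
     (t + t', h + h', c * f (- h) * c' * f (- h') * f (h + h'))"

fun lie_antiproduct :: "(real \<Rightarrow> real) \<Rightarrow> event \<Rightarrow> event \<Rightarrow> event" where
  "lie_antiproduct f (t, h, c) (t', h', c') =
     (t + t', h + h', - c * f (- h) * c' * f (- h') * f (h + h'))"

definition nonzero_events :: "event set" where
  "nonzero_events = {(t, h, c). c \<noteq> 0}"

definition strict_credits :: "event set" where
  "strict_credits = {(t, h, c). c > 0}"

definition strict_debts :: "event set" where
  "strict_debts = {(t, h, c). c < 0}"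

abbreviation event_mfd :: "(event, event) mfd" where
  "event_mfd \<equiv> euclidean_mfd"

end

theory Submission
  imports Defs
begin

text \<open>
  Since \<open>f (- h) = inverse (f h)\<close>, the coordinate \<open>c / f h\<close> turns the Lie product into addition of the
  first two coordinates and multiplication of the third. Hence an event is invertible exactly if
  \<open>c \<noteq> 0\<close>, with inverse \<open>(- t, - h, inverse c)\<close>. The anti-product is the product followed by
  \<open>opposite\<close>, and \<open>opposite\<close> can be pulled out of either factor of the product; so it carries the
  group of credits to the group of debts.

  All the manifolds are open subsets of a Euclidean space, on which the identity is a chart of the
  induced structure. Differentiability therefore reduces to \<^const>\<open>C1_on\<close> for explicit formulas.
\<close>

section \<open>Maps of class C1\<close>

lemma C1_on_subset:
  assumes "C1_on V W g" "W' \<subseteq> W"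
  shows "C1_on V W' g"
proof -
  obtain D where "\<And>x. x \<in> W \<Longrightarrow> (g has_derivative D x) (at x within W)"
    "\<And>v. v \<in> V \<Longrightarrow> continuous_on W (\<lambda>x. D x v)"
    using assms unfolding C1_on_def by blast
  with assms(2) show ?thesis
    unfolding C1_on_def
    by (intro exI[of _ D])
      (blast intro: has_derivative_subset[OF _ assms(2)] continuous_on_subset[OF _ assms(2)])
qed

lemma C1_on_cong:
  assumes "\<And>x. x \<in> W \<Longrightarrow> g x = k x"
  shows "C1_on V W g \<longleftrightarrow> C1_on V W k"
proof -
  have "(g has_derivative E) (at x within W) \<longleftrightarrow> (k has_derivative E) (at x within W)"
    if "x \<in> W" for x E
  proof
    show "(k has_derivative E) (at x within W)" if "(g has_derivative E) (at x within W)"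
      by (rule has_derivative_transform[OF \<open>x \<in> W\<close> _ that]) (simp add: assms)
    show "(g has_derivative E) (at x within W)" if "(k has_derivative E) (at x within W)"
      by (rule has_derivative_transform[OF \<open>x \<in> W\<close> _ that]) (simp add: assms)
  qed
  then show ?thesis unfolding C1_on_def by simp
qed

lemma C1_on_imp_continuous_on: "C1_on V W g \<Longrightarrow> continuous_on W g"
  unfolding C1_on_def by (auto intro: has_derivative_continuous_on)

text \<open>
  Directional continuity of the outer derivative suffices, because the inner one can be expanded in a
  basis.
\<close>

lemma C1_on_compose:
  assumes g: "C1_on V W g" and k: "C1_on UNIV W' k" and sub: "g ` W \<subseteq> W'"
  shows "C1_on V W (\<lambda>x. k (g x))"
proof -
  obtain D where D: "\<And>x. x \<in> W \<Longrightarrow> (g has_derivative D x) (at x within W)"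
    "\<And>v. v \<in> V \<Longrightarrow> continuous_on W (\<lambda>x. D x v)"
    using g unfolding C1_on_def by blast
  obtain E where E: "\<And>x. x \<in> W' \<Longrightarrow> (k has_derivative E x) (at x within W')"
    "\<And>v. continuous_on W' (\<lambda>x. E x v)"
    using k unfolding C1_on_def by blast
  have cont: "continuous_on W (\<lambda>x. E (g x) (D x v))" if v: "v \<in> V" for v
  proof -
    have "E (g x) (D x v) = (\<Sum>b\<in>Basis. (D x v \<bullet> b) *\<^sub>R E (g x) b)" if "x \<in> W" for x
    proof -
      interpret bounded_linear "E (g x)"
        using E(1)[of "g x"] sub that has_derivative_bounded_linear by blast
      have "E (g x) (D x v) = E (g x) (\<Sum>b\<in>Basis. (D x v \<bullet> b) *\<^sub>R b)"
        by (simp add: euclidean_representation)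
      then show ?thesis by (simp add: sum scaleR)
    qed
    moreover have "continuous_on W (\<lambda>x. E (g x) b)" for b
      using continuous_on_compose2[OF E(2) C1_on_imp_continuous_on[OF g] sub] .
    then have "continuous_on W (\<lambda>x. \<Sum>b\<in>Basis. (D x v \<bullet> b) *\<^sub>R E (g x) b)"
      by (intro continuous_intros D(2) v)
    ultimately show ?thesis by (simp cong: continuous_on_cong)
  qed
  have "((\<lambda>x. k (g x)) has_derivative (\<lambda>v. E (g x) (D x v))) (at x within W)" if "x \<in> W" for x
    using has_derivative_in_compose2[OF E(1) sub that D(1)[OF that]] .
  then show ?thesis
    unfolding C1_on_def using cont by (intro exI[of _ "\<lambda>x v. E (g x) (D x v)"]) simp
qed

lemma C1_on_bounded_linear: "bounded_linear g \<Longrightarrow> C1_on V W g"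
  unfolding C1_on_def
  by (intro exI[of _ "\<lambda>x. g"]) (auto intro: bounded_linear_imp_has_derivative)

lemma C1_on_id: "C1_on V W (\<lambda>x. x)"
  by (intro C1_on_bounded_linear bounded_linear_ident)

lemma C1_on_fst: "C1_on V W g \<Longrightarrow> C1_on V W (\<lambda>x. fst (g x))"
  by (rule C1_on_compose[of _ _ _ UNIV]) (auto intro: C1_on_bounded_linear bounded_linear_fst)

lemma C1_on_snd: "C1_on V W g \<Longrightarrow> C1_on V W (\<lambda>x. snd (g x))"
  by (rule C1_on_compose[of _ _ _ UNIV]) (auto intro: C1_on_bounded_linear bounded_linear_snd)

lemma C1_on_minus: "C1_on V W g \<Longrightarrow> C1_on V W (\<lambda>x. - g x)"
  by (rule C1_on_compose[of _ _ _ UNIV uminus])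
    (auto intro: C1_on_bounded_linear bounded_linear_minus[OF bounded_linear_ident])

lemma C1_on_Pair:
  assumes "C1_on V W g" "C1_on V W k"
  shows "C1_on V W (\<lambda>x. (g x, k x))"
proof -
  obtain D E where "\<And>x. x \<in> W \<Longrightarrow> (g has_derivative D x) (at x within W)"
    "\<And>v. v \<in> V \<Longrightarrow> continuous_on W (\<lambda>x. D x v)"
    "\<And>x. x \<in> W \<Longrightarrow> (k has_derivative E x) (at x within W)"
    "\<And>v. v \<in> V \<Longrightarrow> continuous_on W (\<lambda>x. E x v)"
    using assms unfolding C1_on_def by blast
  then show ?thesis
    unfolding C1_on_def
    by (intro exI[of _ "\<lambda>x v. (D x v, E x v)"])
      (auto intro!: has_derivative_Pair continuous_on_Pair)
qed

text \<open>Addition, like multiplication and inversion below, is one fixed map composed with the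
  arguments, so only that map has to be shown to be of class C1.\<close>

lemma C1_on_add:
  assumes "C1_on V W g" "C1_on V W k"
  shows "C1_on V W (\<lambda>x. g x + k x)"
proof -
  have "C1_on UNIV UNIV (\<lambda>p :: 'b \<times> 'b. fst p + snd p)"
    by (intro C1_on_bounded_linear bounded_linear_add bounded_linear_fst bounded_linear_snd)
  from C1_on_compose[OF C1_on_Pair[OF assms] this] show ?thesis by simp
qed

lemma C1_on_mult:
  fixes g k :: "'a::euclidean_space \<Rightarrow> real"
  assumes "C1_on V W g" "C1_on V W k"
  shows "C1_on V W (\<lambda>x. g x * k x)"
proof -
  have "C1_on UNIV UNIV (\<lambda>p :: real \<times> real. fst p * snd p)"
    unfolding C1_on_def
    by (intro exI[of _ "\<lambda>p v. fst p * snd v + fst v * snd p"])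
      (auto intro!: derivative_eq_intros continuous_intros)
  from C1_on_compose[OF C1_on_Pair[OF assms] this] show ?thesis by simp
qed

lemma C1_on_inverse:
  fixes g :: "'a::euclidean_space \<Rightarrow> real"
  assumes "C1_on V W g" "\<And>x. x \<in> W \<Longrightarrow> g x \<noteq> 0"
  shows "C1_on V W (\<lambda>x. inverse (g x))"
proof -
  have "C1_on UNIV (- {0}) (inverse :: real \<Rightarrow> real)"
    unfolding C1_on_def
    by (intro exI[of _ "\<lambda>p v. - (inverse p * v * inverse p)"])
      (auto intro!: has_derivative_inverse' continuous_intros)
  from C1_on_compose[OF assms(1) this] show ?thesis using assms(2) by fastforce
qed

text \<open>The derivative vector \<open>D x\<close> of a map of one variable becomes the linear map
  sending \<open>v\<close> to \<open>v *\<^sub>R D x\<close>.\<close>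

lemma C1_differentiable_imp_C1_on:
  fixes f :: "real \<Rightarrow> 'b::euclidean_space"
  assumes "f C1_differentiable_on W"
  shows "C1_on V W f"
proof -
  obtain D where "\<And>x. x \<in> W \<Longrightarrow> (f has_vector_derivative D x) (at x)" "continuous_on W D"
    using assms unfolding C1_differentiable_on_def by blast
  then show ?thesis
    unfolding C1_on_def
    by (intro exI[of _ "\<lambda>x v. v *\<^sub>R D x"])
      (auto intro!: continuous_intros simp: has_vector_derivative_def has_derivative_at_withinI)
qed

lemmas C1_on_intros =
  C1_on_id C1_on_fst C1_on_snd C1_on_minus C1_on_Pair C1_on_add C1_on_mult C1_on_inverse

section \<open>Open submanifolds of Euclidean spaces\<close>

text \<open>The atlas of \<open>euclidean_mfd\<close> contains only the identity, so compatibility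
  means that the chart and its inverse are of class C1 as maps of Euclidean space.\<close>

lemma mem_max_atlas_euclidean_iff:
  "(U, \<phi>) \<in> max_atlas euclidean_mfd \<longleftrightarrow>
     is_chart euclidean UNIV (U, \<phi>) \<and> C1_on UNIV (\<phi> ` U) (inv_into U \<phi>) \<and> C1_on UNIV U \<phi>"
proof -
  have "inv_into UNIV id = id"
    by (auto simp: inv_into_f_f[of id UNIV, simplified] fun_eq_iff)
  then show ?thesis
    by (simp add: max_atlas_def euclidean_mfd_def C1_compatible_def)
qed

lemma is_chart_inj_on:
  assumes "is_chart X V (U, \<phi>)"
  shows "inj_on \<phi> U"
proof -
  have "U \<subseteq> topspace X" "inj_on \<phi> (topspace (subtopology X U))"
    using assms openin_subset homeomorphic_imp_injective_map unfolding is_chart_def by fast+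
  then show ?thesis by (simp add: Int_absorb1)
qed

text \<open>Outside \<open>S\<close> the value of \<open>inv_into S id\<close> is unspecified, so it
  is replaced by the identity through \<open>C1_on_cong\<close> on \<open>S\<close>.\<close>

lemma inv_into_id: "x \<in> S \<Longrightarrow> inv_into S id x = x"
  using inv_into_f_f[of id S x] by simp

lemma id_in_max_atlas_euclidean: "open S \<Longrightarrow> (S, id) \<in> max_atlas euclidean_mfd"
  unfolding mem_max_atlas_euclidean_iff is_chart_def
  using C1_on_cong[of S "inv_into S id" "\<lambda>x. x"] C1_on_id[of UNIV S]
  by (auto simp: inv_into_id id_def[symmetric])

text \<open>When the slice is the whole model space, the slice condition says that
  \<open>U \<inter> S\<close> and \<open>U\<close> have the same image; injectivity of the chart
  then forces \<open>U \<subseteq> S\<close>.\<close>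

lemma slice_charts_euclidean:
  "slice_charts euclidean_mfd UNIV S = {(U, \<phi>) \<in> max_atlas euclidean_mfd. U \<subseteq> S}"
proof -
  have "\<phi> ` (U \<inter> S) = \<phi> ` U \<longleftrightarrow> U \<subseteq> S"
    if "(U, \<phi>) \<in> max_atlas euclidean_mfd" for U and \<phi> :: "'a \<Rightarrow> 'a"
  proof -
    have "inj_on \<phi> U"
      using that is_chart_inj_on unfolding mem_max_atlas_euclidean_iff by blast
    then have "\<phi> ` (U \<inter> S) = \<phi> ` U \<longleftrightarrow> U \<inter> S = U"
      by (intro inj_on_image_eq_iff) auto
    then show ?thesis by auto
  qed
  then show ?thesis unfolding slice_charts_def by auto
qed

text \<open>The slice charts already lie inside \<open>S\<close>, so restricting their domains to
  \<open>S\<close> changes nothing.\<close>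

lemma submfd_euclidean:
  "submfd euclidean_mfd UNIV S =
     \<lparr>mfd_top = top_of_set S, mfd_model = UNIV,
      mfd_atlas = {(U, \<phi>) \<in> max_atlas euclidean_mfd. U \<subseteq> S}\<rparr>"
proof -
  have "{(U \<inter> S, \<phi>) | U \<phi>. (U, \<phi>) \<in> max_atlas euclidean_mfd \<and> U \<subseteq> S} =
    {(U, \<phi>) \<in> max_atlas euclidean_mfd. U \<subseteq> S}"
    by (auto simp: Int_absorb2)
  then show ?thesis
    unfolding submfd_def slice_charts_euclidean by (simp add: euclidean_mfd_def)
qed

lemma mfd_top_submfd_euclidean [simp]: "mfd_top (submfd euclidean_mfd UNIV S) = top_of_set S"
  and mfd_model_submfd_euclidean [simp]: "mfd_model (submfd euclidean_mfd UNIV S) = UNIV"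
  by (simp_all add: submfd_euclidean)

lemma id_in_atlas_submfd:
  "open S \<Longrightarrow> (S, id) \<in> mfd_atlas (submfd euclidean_mfd UNIV S)"
  by (simp add: submfd_euclidean id_in_max_atlas_euclidean)

lemma submanifold_modelled_on_open:
  "open S \<Longrightarrow> submanifold_modelled_on euclidean_mfd UNIV S"
  unfolding submanifold_modelled_on_def slice_charts_euclidean
  using id_in_max_atlas_euclidean[of S] by (auto simp: euclidean_mfd_def)

section \<open>Euclidean spaces and their open subsets as manifolds\<close>

lemma second_countable_euclidean:
  "second_countable (euclidean :: 'a::second_countable_topology topology)"
proof -
  obtain \<B> :: "'a set set" where \<B>: "countable \<B>" "topological_basis \<B>"
    using ex_countable_basis by blast
  then show ?thesis
    unfolding second_countable_def
    by (intro exI[of _ \<B>]) (metis open_openin topological_basisE topological_basis_open)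
qed

lemma C1_manifold_euclidean: "C1_manifold (euclidean_mfd :: ('a::euclidean_space, 'a) mfd)"
proof -
  have "(UNIV, id) \<in> max_atlas (euclidean_mfd :: ('a, 'a) mfd)"
    by (simp add: id_in_max_atlas_euclidean)
  then show ?thesis
    unfolding C1_manifold_def max_atlas_def
    by (auto simp: euclidean_mfd_def second_countable_euclidean)
qed

text \<open>The change of charts factors through the ambient Euclidean space, where the inverse of
  the first chart and the second chart are both of class C1. The other half of compatibility follows
  by exchanging the charts.\<close>

lemma C1_compatible_max_atlas_euclidean:
  assumes "(U, \<phi>) \<in> max_atlas euclidean_mfd" "(U', \<psi>) \<in> max_atlas euclidean_mfd"
  shows "C1_on UNIV (\<phi> ` (U \<inter> U')) (\<psi> \<circ> inv_into U \<phi>)"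
proof -
  have "inj_on \<phi> U"
    using assms(1) is_chart_inj_on unfolding mem_max_atlas_euclidean_iff by blast
  then have sub: "inv_into U \<phi> ` \<phi> ` (U \<inter> U') \<subseteq> U'" by auto
  have \<phi>: "C1_on UNIV (\<phi> ` U) (inv_into U \<phi>)" and \<psi>: "C1_on UNIV U' \<psi>"
    using assms unfolding mem_max_atlas_euclidean_iff by auto
  have "C1_on UNIV (\<phi> ` (U \<inter> U')) (inv_into U \<phi>)"
    by (rule C1_on_subset[OF \<phi>]) auto
  from C1_on_compose[OF this \<psi> sub] show ?thesis by (simp only: o_def)
qed

text \<open>Relatively open subsets of an open \<open>S\<close> are open, so ambient charts inside
  \<open>S\<close> are charts of \<open>S\<close>; the identity chart alone covers it.\<close>

lemma C1_manifold_open_submfd: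
  assumes "open S"
  shows "C1_manifold (submfd euclidean_mfd UNIV S)"
proof -
  have "is_chart (top_of_set S) UNIV (U, \<phi>)"
    if "(U, \<phi>) \<in> max_atlas euclidean_mfd" "U \<subseteq> S" for U and \<phi> :: "'a \<Rightarrow> 'a"
    using that unfolding mem_max_atlas_euclidean_iff is_chart_def
    by (auto simp: subtopology_subtopology Int_absorb1 openin_open_eq[OF assms])
  moreover have "(\<Union>c\<in>mfd_atlas (submfd euclidean_mfd UNIV S). fst c) = S"
  proof
    show "(\<Union>c\<in>mfd_atlas (submfd euclidean_mfd UNIV S). fst c) \<subseteq> S"
      by (auto simp: submfd_euclidean)
    show "S \<subseteq> (\<Union>c\<in>mfd_atlas (submfd euclidean_mfd UNIV S). fst c)"
      using UN_upper[OF id_in_atlas_submfd[OF assms], of fst] by simp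
  qed
  moreover have "C1_compatible UNIV (U, \<phi>) (U', \<psi>)"
    if "(U, \<phi>) \<in> max_atlas euclidean_mfd" "(U', \<psi>) \<in> max_atlas euclidean_mfd"
    for U U' and \<phi> \<psi> :: "'a \<Rightarrow> 'a"
    using C1_compatible_max_atlas_euclidean[OF that]
      C1_compatible_max_atlas_euclidean[OF that(2) that(1)]
    by (simp add: C1_compatible_def Int_commute)
  ultimately show ?thesis
    unfolding C1_manifold_def
    by (auto simp: submfd_euclidean Hausdorff_space_subtopology second_countable_subtopology
        second_countable_euclidean)
qed

text \<open>With global identity charts on both sides, the same pair of charts serves at every point
  and the local representative is \<open>F\<close> itself.\<close>

lemma C1_map_id_charts:
  assumes tops: "mfd_top M = top_of_set S" "mfd_top N = top_of_set T"
    and id: "(S, id) \<in> mfd_atlas M" "(T, id) \<in> mfd_atlas N"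
    and F: "F ` S \<subseteq> T" "C1_on (mfd_model M) S F"
  shows "C1_map M N F"
  unfolding C1_map_def
proof (intro conjI ballI)
  show "continuous_map (mfd_top M) (mfd_top N) F"
    using F C1_on_imp_continuous_on by (auto simp: tops)
next
  fix p assume p: "p \<in> mfd_carrier M"
  \<comment> \<open>The domain of the local representative is therefore all of
    \<open>S\<close>.\<close>
  have S: "S \<inter> F -` T = S"
    using F(1) by auto
  have "C1_on (mfd_model M) S (id \<circ> F \<circ> inv_into S id)"
    using F(2) C1_on_cong[of S "id \<circ> F \<circ> inv_into S id" F] by (simp add: inv_into_id)
  then have "case (T, id) of (U', \<psi>) \<Rightarrow> p \<in> S \<and> F p \<in> U' \<and>
      C1_on (mfd_model M) (id ` (S \<inter> F -` U')) (\<psi> \<circ> F \<circ> inv_into S id)"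
    using p F(1) S by (auto simp: tops)
  then show "\<exists>(U, \<phi>)\<in>mfd_atlas M. \<exists>(U', \<psi>)\<in>mfd_atlas N. p \<in> U \<and> F p \<in> U' \<and>
      C1_on (mfd_model M) (\<phi> ` (U \<inter> F -` U')) (\<psi> \<circ> F \<circ> inv_into U \<phi>)"
    using id by blast
qed

text \<open>Since \<open>map_prod id id = id\<close>, the product manifold again has a global
  identity chart.\<close>

lemma C1_map_prod_id_charts:
  assumes "mfd_top M = top_of_set S" "mfd_top N = top_of_set T" "mfd_model M = UNIV"
    and "(S, id) \<in> mfd_atlas M" "(T, id) \<in> mfd_atlas N"
    and "F ` (S \<times> S) \<subseteq> T" "C1_on UNIV (S \<times> S) F"
  shows "C1_map (prod_mfd M M) N F"
proof (rule C1_map_id_charts)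
  show "(S \<times> S, id) \<in> mfd_atlas (prod_mfd M M)"
    using assms(4) map_prod.id[symmetric] by (fastforce simp: prod_mfd_def)
qed (use assms in \<open>auto simp: prod_mfd_def\<close>)

text \<open>Resolves the definite description in \<open>alg\<close>: a second neutral element
  \<open>e'\<close> would satisfy \<open>e' = m e e' = e\<close>.\<close>

lemma one_alg_eqI:
  assumes "e \<in> S" "\<And>x. x \<in> S \<Longrightarrow> m e x = x" "\<And>x. x \<in> S \<Longrightarrow> m x e = x"
  shows "\<one>\<^bsub>alg S m\<^esub> = e"
  unfolding alg_def using assms by (auto intro!: the_equality)

lemma alg_simps [simp]: "carrier (alg S m) = S" "mult (alg S m) = m"
  by (simp_all add: alg_def)

text \<open>The abstract \<open>m_inv\<close> is a description without a derivative at hand; the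
  explicit formula \<open>i\<close> agrees with it on \<open>S\<close>, which is all that
  \<open>C1_on\<close> sees.\<close>

lemma lie_group_open_submfdI:
  assumes S: "open S" and G: "Group.group (alg S m)"
    and mult: "C1_on UNIV (S \<times> S) (\<lambda>(x, y). m x y)"
    and inv: "\<And>x. x \<in> S \<Longrightarrow> inv\<^bsub>alg S m\<^esub> x = i x" "C1_on UNIV S i"
  shows "lie_group (submfd euclidean_mfd UNIV S) m"
proof -
  interpret Group.group "alg S m" by (fact G)
  have "C1_on UNIV S (m_inv (alg S m))"
    using inv C1_on_cong[of S "m_inv (alg S m)" i] by simp
  moreover have "(\<lambda>(x, y). m x y) ` (S \<times> S) \<subseteq> S" "m_inv (alg S m) ` S \<subseteq> S"
    using m_closed inv_closed by auto
  ultimately show ?thesis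
    unfolding lie_group_def
    using S G mult id_in_atlas_submfd
    by (auto intro!: C1_manifold_open_submfd C1_map_id_charts[of _ S _ S]
        C1_map_prod_id_charts[of _ S _ S])
qed

text \<open>Each of the two sets is the complement of the other, hence clopen. A component lies
  inside a clopen set or misses it, and a connected set lies inside the component of each of its
  points.\<close>

lemma connected_components_of_eq_pair:
  assumes op: "openin X A" "openin X B" and un: "A \<union> B = topspace X" and dj: "A \<inter> B = {}"
    and "connectedin X A" "connectedin X B" and ne: "A \<noteq> {}" "B \<noteq> {}"
  shows "connected_components_of X = {A, B}"
proof -
  \<comment> \<open>The sets are quantified afresh so that the fact applies a second time with their
    roles exchanged.\<close>
  have eq: "connected_component_of_set X x = A"
    if "openin X A" "openin X B" "A \<union> B = topspace X" "A \<inter> B = {}" "connectedin X A" "x \<in> A"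
    for A B x
  proof
    show "A \<subseteq> connected_component_of_set X x"
      using that by (intro connected_component_of_maximal)
    have "topspace X - B = A" using that by auto
    then have "closedin X A" using closedin_diff[OF closedin_topspace that(2)] by simp
    then have "connected_component_of_set X x \<subseteq> A \<or> disjnt (connected_component_of_set X x) A"
      using that connectedin_connected_component_of by (metis connectedin_clopen_cases)
    moreover have "x \<in> connected_component_of_set X x"
      using that by (auto simp: connected_component_of_refl)
    ultimately show "connected_component_of_set X x \<subseteq> A"
      using that by (auto simp: disjnt_iff)
  qed
  have "connected_component_of_set X x = A" if "x \<in> A" for x
    using eq[of A B x] assms that by blast
  moreover have "connected_component_of_set X x = B" if "x \<in> B" for x
    using eq[of B A x] assms that by blast
  ultimately show ?thesis
    unfolding connected_components_of_def un[symmetric] using ne by (auto simp: image_Un)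
qed

section \<open>Credits and debts\<close>

text \<open>In product form, openness and convexity can be checked factor by factor.\<close>

lemma strict_credits_eq: "strict_credits = UNIV \<times> UNIV \<times> {0<..}"
  and strict_debts_eq: "strict_debts = UNIV \<times> UNIV \<times> {..<0}"
  and nonzero_events_eq: "nonzero_events = UNIV \<times> UNIV \<times> - {0}"
  by (auto simp: strict_credits_def strict_debts_def nonzero_events_def)

lemma open_event_sets:
  "open strict_credits" "open strict_debts" "open nonzero_events"
  unfolding strict_credits_eq strict_debts_eq nonzero_events_eq by (intro open_Times; simp add: open_Compl)+

lemma connected_event_sets: "connected strict_credits" "connected strict_debts"
  unfolding strict_credits_eq strict_debts_eq
  by (intro convex_connected convex_Times; simp add: convex_real_interval)+

lemma connected_components_nonzero_events:
  "connected_components_of (top_of_set nonzero_events) = {strict_credits, strict_debts}"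
proof (rule connected_components_of_eq_pair)
  show "openin (top_of_set nonzero_events) strict_credits"
    "openin (top_of_set nonzero_events) strict_debts"
    using open_event_sets
    by (auto simp: openin_open_eq strict_credits_def strict_debts_def nonzero_events_def)
  show "connectedin (top_of_set nonzero_events) strict_credits"
    "connectedin (top_of_set nonzero_events) strict_debts"
    using connected_event_sets
    by (auto simp: connectedin_subtopology strict_credits_def strict_debts_def nonzero_events_def)
  show "strict_credits \<noteq> {}" "strict_debts \<noteq> {}"
    unfolding strict_credits_eq strict_debts_eq by simp_all
qed (auto simp: strict_credits_def strict_debts_def nonzero_events_def)

section \<open>The opposite as a differentiable involution\<close>

lemma opposite_eq: "opposite = (\<lambda>(t, h, c). (t, h, - c))"
  by auto

lemma opposite_opposite [simp]: "opposite (opposite x) = x"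
  by (cases x) simp

text \<open>Applying the involution to each of the two inclusions gives the reverse of the
  other.\<close>

lemma opposite_image: "opposite ` strict_credits = strict_debts"
  "opposite ` strict_debts = strict_credits"
proof -
  have "opposite ` strict_credits \<subseteq> strict_debts" "opposite ` strict_debts \<subseteq> strict_credits"
    by (auto simp: strict_credits_def strict_debts_def)
  moreover have "opposite ` opposite ` X = X" for X
    by (simp add: image_image)
  ultimately show "opposite ` strict_credits = strict_debts"
    "opposite ` strict_debts = strict_credits"
    by (metis image_mono subset_antisym)+
qed

lemma C1_on_opposite: "C1_on V W opposite"
proof -
  have eq: "opposite = (\<lambda>x. (fst x, fst (snd x), - snd (snd x)))"
    by auto
  show ?thesis unfolding eq by (intro C1_on_intros)
qed

lemma credits_homeomorphic_debts:
  "top_of_set strict_credits homeomorphic_space top_of_set strict_debts"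
proof -
  have "continuous_map (top_of_set A) (top_of_set B) opposite" if "opposite ` A = B" for A B
    using that C1_on_imp_continuous_on[OF C1_on_opposite[of UNIV]] by auto
  from this[OF opposite_image(1)] this[OF opposite_image(2)] show ?thesis
    unfolding homeomorphic_space_def homeomorphic_maps_def by (metis opposite_opposite)
qed

text \<open>On \<open>strict_debts\<close> the inverse map is \<open>opposite\<close> again, so one
  differentiability fact serves both directions.\<close>

lemma C1_diffeomorphism_opposite:
  "C1_diffeomorphism (submfd euclidean_mfd UNIV strict_credits)
     (submfd euclidean_mfd UNIV strict_debts) opposite"
proof -
  have inj: "inj_on opposite strict_credits"
    by (metis inj_onI opposite_opposite)
  have inv: "inv_into strict_credits opposite x = opposite x" if "x \<in> strict_debts" for x
  proof -
    have "opposite x \<in> strict_credits" using that opposite_image(2) by blast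
    from inv_into_f_f[OF inj this] show ?thesis by simp
  qed
  have "C1_on UNIV strict_debts (inv_into strict_credits opposite)"
    using C1_on_cong[of strict_debts _ opposite, OF inv] C1_on_opposite by metis
  moreover have "inv_into strict_credits opposite ` strict_debts \<subseteq> strict_credits"
    using image_cong[of strict_debts _ _ opposite, OF refl inv] opposite_image(2) by simp
  ultimately have "C1_map (submfd euclidean_mfd UNIV strict_debts)
      (submfd euclidean_mfd UNIV strict_credits) (inv_into strict_credits opposite)"
    by (intro C1_map_id_charts[of _ strict_debts _ strict_credits])
      (simp_all add: id_in_atlas_submfd open_event_sets)
  moreover have "C1_map (submfd euclidean_mfd UNIV strict_credits)
      (submfd euclidean_mfd UNIV strict_debts) opposite"
    by (rule C1_map_id_charts[of _ strict_credits _ strict_debts])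
      (simp_all add: id_in_atlas_submfd open_event_sets C1_on_opposite opposite_image)
  ultimately show ?thesis
    unfolding C1_diffeomorphism_def bij_betw_def using inj opposite_image(1) by simp
qed

section \<open>The Lie product of a capitalization factor\<close>

locale capitalization_factor =
  fixes f :: "real \<Rightarrow> real"
  assumes factor: "C1_capitalization_factor f"
begin

lemma f_pos: "f h > 0" and f_0 [simp]: "f 0 = 1" and f_uminus [simp]: "f (- h) = inverse (f h)"
  using factor by (auto simp: C1_capitalization_factor_def)

lemma f_nonzero [simp]: "f h \<noteq> 0"
  using f_pos[of h] by simp

lemma C1_on_f: "C1_on V W g \<Longrightarrow> C1_on V W (\<lambda>x. f (g x))"
  using factor C1_differentiable_imp_C1_on[of f UNIV]
  by (auto simp: C1_capitalization_factor_def intro: C1_on_compose[of _ _ _ UNIV f])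

lemma C1_on_lie_product: "C1_on V W (\<lambda>(x, y). lie_product f x y)"
proof -
  have eq: "(\<lambda>(x, y). lie_product f x y) = (\<lambda>p. (fst (fst p) + fst (snd p),
      fst (snd (fst p)) + fst (snd (snd p)),
      snd (snd (fst p)) * f (- fst (snd (fst p))) * snd (snd (snd p)) * f (- fst (snd (snd p))) *
        f (fst (snd (fst p)) + fst (snd (snd p)))))"
    by auto
  show ?thesis unfolding eq by (intro C1_on_intros C1_on_f)
qed

lemma lie_antiproduct_eq: "lie_antiproduct f x y = opposite (lie_product f x y)"
  by (cases x; cases y) simp

lemma C1_on_lie_antiproduct: "C1_on V W (\<lambda>(x, y). lie_antiproduct f x y)"
  unfolding lie_antiproduct_eq
  using C1_on_compose[OF C1_on_lie_product C1_on_opposite[of _ UNIV]] by (simp add: case_prod_unfold)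

text \<open>The third coordinate of the product is linear in each capital, and
  \<open>opposite\<close> leaves the arguments of \<open>f\<close> unchanged.\<close>

lemma lie_product_opposite:
  "lie_product f (opposite x) y = opposite (lie_product f x y)"
  "lie_product f x (opposite y) = opposite (lie_product f x y)"
  by (cases x; cases y; simp)+

lemma lie_product_commute: "lie_product f x y = lie_product f y x"
  by (cases x; cases y) (simp add: algebra_simps)

text \<open>The factor \<open>f (h + h')\<close> created by the inner product is cancelled when the
  outer product divides by it. Both bracketings have the third coordinate
  \<open>c * c' * c'' * f (h + h' + h'') / (f h * f h' * f h'')\<close>.\<close>

lemma lie_product_assoc:
  "lie_product f (lie_product f x y) z = lie_product f x (lie_product f y z)"
proof -
  have eq: "lie_product f (t, h, c) (t', h', c') =
      (t + t', h + h', c * c' * f (h + h') / (f h * f h'))" for t h c t' h' c'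
    by (simp add: field_simps)
  show ?thesis
    by (cases x; cases y; cases z) (simp add: eq field_simps del: lie_product.simps)
qed

section \<open>The origin and the semigroup of all events\<close>

lemma lie_product_origin [simp]:
  "lie_product f (0, 0, 1) x = x" "lie_product f x (0, 0, 1) = x"
  by (cases x; simp)+

lemma origin_lie_product: "origin event_mfd (lie_product f) = (0, 0, 1)"
  unfolding origin_def by (rule one_alg_eqI) (auto simp: euclidean_mfd_def)

lemma comm_monoid_lie_product: "Group.comm_monoid (alg UNIV (lie_product f))"
proof -
  have "\<one>\<^bsub>alg UNIV (lie_product f)\<^esub> = (0, 0, 1)" by (rule one_alg_eqI) auto
  then show ?thesis
    by (intro comm_monoidI) (auto simp: lie_product_assoc intro: lie_product_commute)
qed

lemma abelian_lie_semigroup_events: "abelian_lie_semigroup event_mfd (lie_product f)"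
proof -
  have "C1_map (prod_mfd event_mfd event_mfd) event_mfd (\<lambda>(x, y). lie_product f x y)"
    by (rule C1_map_prod_id_charts[of _ UNIV _ UNIV])
      (auto simp: euclidean_mfd_def C1_on_lie_product)
  then show ?thesis
    unfolding abelian_lie_semigroup_def lie_semigroup_def
    using comm_monoid_lie_product C1_manifold_euclidean
    by (auto simp: euclidean_mfd_def comm_monoid_def)
qed

text \<open>The formula is free of \<open>f\<close> because \<open>f h * f (- h) * f 0 = 1\<close>.
  It gives the inverse for the product and, on debts, for the anti-product as well.\<close>

definition inverse_event :: "event \<Rightarrow> event" where
  "inverse_event x = (- fst x, - fst (snd x), inverse (snd (snd x)))"

lemma lie_product_inverse_event:
  "x \<in> nonzero_events \<Longrightarrow> lie_product f (inverse_event x) x = (0, 0, 1)"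
  by (cases x) (simp add: inverse_event_def nonzero_events_def field_simps)

lemma inverse_event_mem:
  "x \<in> nonzero_events \<Longrightarrow> inverse_event x \<in> nonzero_events"
  "x \<in> strict_credits \<Longrightarrow> inverse_event x \<in> strict_credits"
  "x \<in> strict_debts \<Longrightarrow> inverse_event x \<in> strict_debts"
  by (auto simp: inverse_event_def nonzero_events_def strict_credits_def strict_debts_def)

lemma C1_on_inverse_event: "W \<subseteq> nonzero_events \<Longrightarrow> C1_on V W inverse_event"
  unfolding inverse_event_def by (intro C1_on_intros) (auto simp: nonzero_events_def)

section \<open>Groups of non-zero events, credits and debts\<close>

lemma credits_debts_subset:
  "strict_credits \<subseteq> nonzero_events" "strict_debts \<subseteq> nonzero_events"
  by (auto simp: nonzero_events_def strict_credits_def strict_debts_def)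

text \<open>As \<open>f\<close> is positive, signs multiply as for real numbers. Two debts give a
  credit, which is why the debts need the anti-product.\<close>

lemma lie_product_mem:
  "x \<in> nonzero_events \<Longrightarrow> y \<in> nonzero_events \<Longrightarrow> lie_product f x y \<in> nonzero_events"
  "x \<in> strict_credits \<Longrightarrow> y \<in> strict_credits \<Longrightarrow> lie_product f x y \<in> strict_credits"
  "x \<in> strict_debts \<Longrightarrow> y \<in> strict_debts \<Longrightarrow> lie_product f x y \<in> strict_credits"
  by (auto simp: nonzero_events_def strict_credits_def strict_debts_def f_pos
      mult_neg_neg mult_neg_pos)

text \<open>An event with third coordinate 0 has only products with third coordinate 0, never the
  origin. Conversely \<open>inverse_event\<close> is a left inverse, and commutativity makes it
  two-sided.\<close>

lemma nonzero_events_eq_Units: "nonzero_events = Units (alg UNIV (lie_product f))"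
proof -
  have one: "\<one>\<^bsub>alg UNIV (lie_product f)\<^esub> = (0, 0, 1)" by (rule one_alg_eqI) auto
  have "x \<in> nonzero_events" if "lie_product f y x = (0, 0, 1)" for x y
    using that by (cases x; cases y) (auto simp: nonzero_events_def)
  moreover have "\<exists>y. lie_product f y x = (0, 0, 1) \<and> lie_product f x y = (0, 0, 1)"
    if "x \<in> nonzero_events" for x
    using that lie_product_inverse_event lie_product_commute by metis
  ultimately show ?thesis
    unfolding Units_def by (auto simp: one)
qed

text \<open>A general \<open>S\<close> covers the non-zero events and the credits at once.\<close>

lemma group_lie_product:
  assumes S: "S \<subseteq> nonzero_events" "(0, 0, 1) \<in> S"
    and closed: "\<And>x y. x \<in> S \<Longrightarrow> y \<in> S \<Longrightarrow> lie_product f x y \<in> S"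
      "\<And>x. x \<in> S \<Longrightarrow> inverse_event x \<in> S"
  shows "Group.group (alg S (lie_product f))"
    and "\<one>\<^bsub>alg S (lie_product f)\<^esub> = (0, 0, 1)"
    and "\<And>x. x \<in> S \<Longrightarrow> inv\<^bsub>alg S (lie_product f)\<^esub> x = inverse_event x"
proof -
  show one: "\<one>\<^bsub>alg S (lie_product f)\<^esub> = (0, 0, 1)"
    using S by (intro one_alg_eqI) auto
  have inv: "lie_product f (inverse_event x) x = (0, 0, 1)" if "x \<in> S" for x
    using that S lie_product_inverse_event by blast
  show G: "Group.group (alg S (lie_product f))"
  proof (rule groupI)
    show "\<exists>y\<in>carrier (alg S (lie_product f)).
        y \<otimes>\<^bsub>alg S (lie_product f)\<^esub> x = \<one>\<^bsub>alg S (lie_product f)\<^esub>"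
      if "x \<in> carrier (alg S (lie_product f))" for x
      using that inv closed(2) unfolding alg_simps one by blast
  qed (simp_all only: alg_simps one S closed lie_product_origin lie_product_assoc)
  show "inv\<^bsub>alg S (lie_product f)\<^esub> x = inverse_event x" if "x \<in> S" for x
    using that by (intro group.inv_equality[OF G]) (auto simp: one inv closed)
qed

lemma lie_group_lie_product:
  assumes "open S" "S \<subseteq> nonzero_events" "(0, 0, 1) \<in> S"
    and "\<And>x y. x \<in> S \<Longrightarrow> y \<in> S \<Longrightarrow> lie_product f x y \<in> S"
      "\<And>x. x \<in> S \<Longrightarrow> inverse_event x \<in> S"
  shows "lie_group (submfd event_mfd UNIV S) (lie_product f)"
  using assms
  by (intro lie_group_open_submfdI[where i = inverse_event] group_lie_product
      C1_on_lie_product C1_on_inverse_event)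

lemma origin_mem: "(0, 0, 1) \<in> nonzero_events" "(0, 0, 1) \<in> strict_credits"
  by (auto simp: nonzero_events_def strict_credits_def)

text \<open>Every law follows from that of the product by pulling out \<open>opposite\<close>. The
  neutral element becomes the opposite of the origin, while inverses keep the same formula.\<close>

lemma group_lie_antiproduct:
  shows "Group.group (alg strict_debts (lie_antiproduct f))"
    and "\<And>x. x \<in> strict_debts \<Longrightarrow> inv\<^bsub>alg strict_debts (lie_antiproduct f)\<^esub> x = inverse_event x"
proof -
  let ?o = "(0, 0, -1) :: event"
  have o: "?o = opposite (0, 0, 1)" "?o \<in> strict_debts"
    by (auto simp: strict_debts_def)
  have neutral: "lie_antiproduct f ?o x = x" "lie_antiproduct f x ?o = x" for x
    by (simp_all only: o lie_antiproduct_eq lie_product_opposite lie_product_origin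
        opposite_opposite)
  have one: "\<one>\<^bsub>alg strict_debts (lie_antiproduct f)\<^esub> = ?o"
    by (intro one_alg_eqI o neutral)
  \<comment> \<open>The product of two debts is a credit, and the final \<open>opposite\<close>
    returns it to the debts.\<close>
  have closed: "lie_antiproduct f x y \<in> strict_debts"
    if "x \<in> strict_debts" "y \<in> strict_debts" for x y
    using lie_product_mem(3)[OF that] opposite_image unfolding lie_antiproduct_eq by blast
  have assoc: "lie_antiproduct f (lie_antiproduct f x y) z =
      lie_antiproduct f x (lie_antiproduct f y z)" for x y z
    by (simp only: lie_antiproduct_eq lie_product_opposite lie_product_assoc)
  have inv: "lie_antiproduct f (inverse_event x) x = ?o" if "x \<in> strict_debts" for x
    using subsetD[OF credits_debts_subset(2) that]
    by (simp add: lie_antiproduct_eq lie_product_inverse_event)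
  show G: "Group.group (alg strict_debts (lie_antiproduct f))"
  proof (rule groupI)
    show "\<exists>y\<in>carrier (alg strict_debts (lie_antiproduct f)).
        y \<otimes>\<^bsub>alg strict_debts (lie_antiproduct f)\<^esub> x = \<one>\<^bsub>alg strict_debts (lie_antiproduct f)\<^esub>"
      if "x \<in> carrier (alg strict_debts (lie_antiproduct f))" for x
      using that inv inverse_event_mem(3) unfolding alg_simps one by blast
  qed (simp_all only: alg_simps one o(2) closed neutral assoc)
  show "inv\<^bsub>alg strict_debts (lie_antiproduct f)\<^esub> x = inverse_event x" if "x \<in> strict_debts" for x
    using that by (intro group.inv_equality[OF G]) (auto simp: one inv inverse_event_mem)
qed

lemmas group_nonzero_events =
  group_lie_product[OF subset_refl origin_mem(1) lie_product_mem(1) inverse_event_mem(1)]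

lemma lie_group_nonzero_events: "lie_group (submfd event_mfd UNIV nonzero_events) (lie_product f)"
  by (intro lie_group_lie_product open_event_sets origin_mem lie_product_mem inverse_event_mem) auto

lemma lie_group_isomorphism_opposite:
  "lie_group_isomorphism (submfd event_mfd UNIV strict_credits) (lie_product f)
     (submfd event_mfd UNIV strict_debts) (lie_antiproduct f) opposite"
proof -
  have "lie_group (submfd event_mfd UNIV strict_credits) (lie_product f)"
    by (intro lie_group_lie_product open_event_sets origin_mem lie_product_mem inverse_event_mem
        credits_debts_subset)
  moreover have "lie_group (submfd event_mfd UNIV strict_debts) (lie_antiproduct f)"
    by (intro lie_group_open_submfdI[where i = inverse_event] open_event_sets
        group_lie_antiproduct C1_on_lie_antiproduct C1_on_inverse_event credits_debts_subset)
  \<comment> \<open>Bijectivity comes from the diffeomorphism. In the anti-product of two opposites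
    three signs meet, two of which cancel.\<close>
  moreover have "opposite \<in> iso (alg strict_credits (lie_product f))
      (alg strict_debts (lie_antiproduct f))"
    using C1_diffeomorphism_opposite opposite_image
    by (auto simp: iso_def hom_def C1_diffeomorphism_def lie_antiproduct_eq lie_product_opposite)
  ultimately show ?thesis
    unfolding lie_group_isomorphism_def using C1_diffeomorphism_opposite by simp
qed

lemma subgroup_strict_credits: "subgroup strict_credits (alg nonzero_events (lie_product f))"
  using credits_debts_subset(1)
  by (intro subgroup.intro)
    (auto simp: group_nonzero_events origin_mem lie_product_mem inverse_event_mem subset_iff)

text \<open>The model space required by \<open>lie_subgroup\<close> is all of \<open>UNIV\<close>,
  the case of an open submanifold.\<close>

lemma lie_subgroup_nonzero_events: "lie_subgroup event_mfd (lie_product f) nonzero_events"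
  unfolding lie_subgroup_def origin_lie_product
  using lie_group_nonzero_events submanifold_modelled_on_open[OF open_event_sets(3)]
  by (auto intro: origin_mem lie_product_mem)

end

theorem theorem1:
  fixes f :: "real \<Rightarrow> real"
  assumes "C1_capitalization_factor f"
  shows
    "abelian_lie_semigroup event_mfd (lie_product f) \<and>

     origin event_mfd (lie_product f) = (0, 0, 1) \<and>

     (lie_subgroup event_mfd (lie_product f) nonzero_events \<and>
      nonzero_events = Units (alg UNIV (lie_product f))) \<and>

     (let G = open_submfd event_mfd nonzero_events in
        lie_group G (lie_product f) \<and>
        card (connected_components_of (mfd_top G)) = 2 \<and>
        connected_components_of (mfd_top G) = {strict_credits, strict_debts} \<and>
        subtopology (mfd_top G) strict_credits homeomorphic_space
          subtopology (mfd_top G) strict_debts \<and>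
        origin event_mfd (lie_product f) \<in> strict_credits \<and>
        subgroup strict_credits (alg nonzero_events (lie_product f)) \<and>
        opposite (origin event_mfd (lie_product f)) = (0, 0, -1) \<and>
        (0, 0, -1) \<in> strict_debts \<and>
        Group.group (alg strict_debts (lie_antiproduct f))) \<and>

     lie_group_isomorphism
       (open_submfd event_mfd strict_credits) (lie_product f)
       (open_submfd event_mfd strict_debts) (lie_antiproduct f)
       (\<lambda>(t, h, c). (t, h, - c))"
proof -
  interpret capitalization_factor f by standard (fact assms)
  have model: "mfd_model event_mfd = UNIV" by (simp add: euclidean_mfd_def)
  have top: "subtopology (top_of_set nonzero_events) strict_credits = top_of_set strict_credits"
    "subtopology (top_of_set nonzero_events) strict_debts = top_of_set strict_debts"
    using credits_debts_subset by (simp_all add: subtopology_subtopology Int_absorb1)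
  \<comment> \<open>The origin separates the two half-spaces; their being different makes the number
    of components exactly 2.\<close>
  have "(0, 0, 1) \<notin> strict_debts" by (simp add: strict_debts_def)
  then have neq: "strict_credits \<noteq> strict_debts"
    using origin_mem(2) by metis
  have debt: "(0, 0, -1) \<in> strict_debts" by (simp add: strict_debts_def)
  show ?thesis
    unfolding Let_def model opposite_eq[symmetric] mfd_top_submfd_euclidean top
      connected_components_nonzero_events origin_lie_product
    using abelian_lie_semigroup_events lie_subgroup_nonzero_events nonzero_events_eq_Units
      lie_group_nonzero_events credits_homeomorphic_debts origin_mem(2) subgroup_strict_credits
      debt group_lie_antiproduct(1) lie_group_isomorphism_opposite neq
    by simp
qed

end
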